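(* Let $(\mathcal{H},\mathcal{E}_t)$ be a multiplicity-free, 2-homogeneous quantum metric $G$-space of diameter $r$, with homomorphism $R:G\to\operatorname{Isom}(\mathcal{H},\mathcal{E}_t)$ and $W_t(j)$ coefficients $W_t(j)$. Assume it is self-dual, with self-dual isomorphism given by a unitary map $\Lambda:\mathcal{H}\to\mathcal{H}$, i.e. $\Lambda\overline{R(g)}\Lambda^*=R(g)$ for all $g\in G$ (complex conjugation being taken with respect to a fixed orthonormal basis of $\mathcal{H}$). Let $\mathcal{T}:\mathcal{L}(\mathcal{H})_{\mathbb{R}}\to\mathcal{L}(\mathcal{H})_{\mathbb{R}}$ be $\mathcal{T}(X)=\Lambda\overline{X}\Lambda^*$, with expansion $\mathcal{T}=\sum_{j=0}^{r}\lambda_j\Pi_j$, $\lambda_j\in\mathbb{R}$. Then the distance distribution $(A_t)_{0\le t\le r}$ of any quantum code $\mathcal{C}\subseteq\mathcal{H}$ satisfies $$\sum_{j=0}^{r}\lambda_jW_t(j)A_j\ge0\qquad\text{for }0\le t\le r.$$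
   Context: Quantum metric: $\mathcal{H}$ is a finite-dimensional complex Hilbert space and $\mathcal{L}(\mathcal{H})$ its space of linear operators, with Hilbert–Schmidt inner product $\langle E,F\rangle=\operatorname{tr}(E^*F)$. Given a subspace $\mathcal{E}\subseteq\mathcal{L}(\mathcal{H})$ with $I_{\mathcal{H}}\in\mathcal{E}$ and $\mathcal{E}^*=\mathcal{E}$ (closed under adjoints), the quantum graph metric generated by $\mathcal{E}$ is the family $\mathcal{E}_t=\mathbb{C}I_{\mathcal{H}}$ for $0\le t<1$ and $\mathcal{E}_t=\mathcal{E}^{\lfloor t\rfloor}$ (span of products of $\lfloor t\rfloor$ elements of $\mathcal{E}$) for $t\ge1$. It is assumed connected: $\mathcal{E}_r=\mathcal{L}(\mathcal{H})$ for some finite $r$; the smallest such $r$ is the diameter. Put $\mathcal{V}_0=\mathbb{C}I_{\mathcal{H}}$ and $\mathcal{V}_t=\mathcal{E}_t\cap\mathcal{E}_{t-1}^{\perp}$ for integers $1\le t\le r$, so $\mathcal{L}(\mathcal{H})=\bigoplus_{t=0}^r\mathcal{V}_t$ orthogonally. Symmetry: $\operatorname{Isom}(\mathcal{H},\mathcal{E}_t)$ is the group of unitaries $U$ on $\mathcal{H}$ with $\mathcal{E}_t\subseteq U^*\mathcal{E}_tU$ for all $t\ge0$. For a group $G$, $(\mathcal{H},\mathcal{E}_t)$ is a quantum metric $G$-space if a homomorphism $R:G\to\operatorname{Isom}(\mathcal{H},\mathcal{E}_t)$ is given; $G$ then acts on $\mathcal{L}(\mathcal{H})$ by $g\cdot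 E=R(g)ER(g)^*$. It is multiplicity-free if $\mathcal{L}(\mathcal{H})$ is a multiplicity-free representation of $G$ under this action, and 2-homogeneous if each $\mathcal{V}_t$ is an irreducible representation of $G$. It is self-dual if $\mathcal{H}$ is a self-dual representation of $G$ (isomorphic to its dual, which in a fixed orthonormal basis is $g\mapsto\overline{R(g)}$). Superoperators: let $\mathcal{L}(\mathcal{H})_{\mathbb{R}}$ be the real space of self-adjoint operators. With $\mathcal{B}_t$ any orthonormal basis of $\mathcal{V}_t$, define on $\mathcal{L}(\mathcal{H})_{\mathbb{R}}$ the maps $\Phi_t(X)=\sum_{E\in\mathcal{B}_t}EXE^*$ and $\Pi_t(X)=\sum_{E\in\mathcal{B}_t}\operatorname{tr}(E^*X)E$ (the orthogonal projection onto $\mathcal{V}_t$); both are independent of the choice of $\mathcal{B}_t$. The $W_t(j)$ coefficients are the (existing, unique) real numbers with $\Phi_t=\sum_{j=0}^rW_t(j)\Pi_j$ for $0\le t\le r$. Quantum codes: a quantum code is a subspace $\mathcal{C}\subseteq\mathcal{H}$, with orthogonal projection $P$; its distance distribution is $A_t=\frac{\dim\mathcal{H}}{\dim\mathcal{C}}\operatorname{tr}(P\,\Pi_t(P))$ for $0\le t\le r$. *)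

theory Defs
  imports "HOL-Analysis.Analysis" "HOL-Algebra.Group"
begin

text \<open>
  The Hilbert space is \<open>complex ^ 'n\<close> with the inner product making the standard basis
  orthonormal; this standard basis is also the fixed orthonormal basis with respect to which
  complex conjugation is taken. Operators are square matrices.
\<close>

type_synonym 'n cop = "complex ^ 'n ^ 'n"


subsection \<open>Operators\<close>

text \<open>
  On \<open>complex ^ 'n ^ 'n\<close> the library only provides scaling by reals (\<open>*\<^sub>R\<close>) and by
  elements of \<open>complex ^ 'n\<close> (\<open>*s\<close>), so the complex vector space structure is introduced here.
\<close>

definition cscale :: "complex \<Rightarrow> 'n::finite cop \<Rightarrow> 'n cop" where
  "cscale c A = map_matrix (\<lambda>z. c * z) A"

global_interpretation cop: vector_space "cscale :: complex \<Rightarrow> 'n::finite cop \<Rightarrow> 'n cop"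
  by unfold_locales (simp_all add: cscale_def vec_eq_iff algebra_simps)

definition conj_mat :: "'n::finite cop \<Rightarrow> 'n cop" where
  "conj_mat A = map_matrix cnj A"

definition adj_mat :: "'n::finite cop \<Rightarrow> 'n cop" where
  "adj_mat A = transpose (conj_mat A)"

definition self_adjoint :: "'n::finite cop \<Rightarrow> bool" where
  "self_adjoint A \<longleftrightarrow> adj_mat A = A"

definition unitary :: "'n::finite cop \<Rightarrow> bool" where
  "unitary U \<longleftrightarrow> adj_mat U ** U = mat 1 \<and> U ** adj_mat U = mat 1"

definition hs_inner :: "'n::finite cop \<Rightarrow> 'n cop \<Rightarrow> complex" where
  "hs_inner E F = trace (adj_mat E ** F)"

definition hs_perp :: "'n::finite cop set \<Rightarrow> 'n cop set" where
  "hs_perp S = {F. \<forall>E\<in>S. hs_inner E F = 0}"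

definition is_onb :: "'n::finite cop set \<Rightarrow> 'n cop set \<Rightarrow> bool" where
  "is_onb B V \<longleftrightarrow> finite B \<and> cop.span B = V \<and>
     (\<forall>E\<in>B. \<forall>F\<in>B. hs_inner E F = (if E = F then 1 else 0))"


subsection \<open>Quantum graph metrics\<close>

definition generating_space :: "'n::finite cop set \<Rightarrow> bool" where
  "generating_space S \<longleftrightarrow> cop.subspace S \<and> mat 1 \<in> S \<and> adj_mat ` S = S"

definition op_power :: "'n::finite cop set \<Rightarrow> nat \<Rightarrow> 'n cop set" where
  "op_power S k = cop.span {foldr (**) Es (mat 1) |Es. length Es = k \<and> set Es \<subseteq> S}"

definition graph_metric :: "'n::finite cop set \<Rightarrow> real \<Rightarrow> 'n cop set" where
  "graph_metric S t = (if t < 1 then cop.span {mat 1} else op_power S (nat \<lfloor>t\<rfloor>))"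

text \<open>
  Connectedness is part of \<open>has_diameter\<close>. The family \<open>graph_metric S\<close> is constant between
  consecutive integers, so a smallest radius is always a natural number.
\<close>

definition has_diameter :: "'n::finite cop set \<Rightarrow> nat \<Rightarrow> bool" where
  "has_diameter S r \<longleftrightarrow> graph_metric S (real r) = UNIV \<and>
     (\<forall>s. 0 \<le> s \<and> s < real r \<longrightarrow> graph_metric S s \<noteq> UNIV)"

definition layer :: "'n::finite cop set \<Rightarrow> nat \<Rightarrow> 'n cop set" where
  "layer S t = (if t = 0 then cop.span {mat 1}
     else graph_metric S (real t) \<inter> hs_perp (graph_metric S (real t - 1)))"


subsection \<open>Symmetry\<close>

definition isom_group :: "(real \<Rightarrow> 'n::finite cop set) \<Rightarrow> 'n cop monoid" where
  "isom_group M =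
     \<lparr>carrier = {U. unitary U \<and> (\<forall>t\<ge>0. M t \<subseteq> (\<lambda>X. adj_mat U ** X ** U) ` M t)},
      mult = (**), one = mat 1\<rparr>"

definition op_action :: "('g \<Rightarrow> 'n::finite cop) \<Rightarrow> 'g \<Rightarrow> 'n cop \<Rightarrow> 'n cop" where
  "op_action R g E = R g ** E ** adj_mat (R g)"

definition invariant_subspace ::
    "('g, 'm) monoid_scheme \<Rightarrow> ('g \<Rightarrow> 'n::finite cop \<Rightarrow> 'n cop) \<Rightarrow> 'n cop set \<Rightarrow> bool" where
  "invariant_subspace G \<rho> W \<longleftrightarrow> cop.subspace W \<and> (\<forall>g\<in>carrier G. \<forall>X\<in>W. \<rho> g X \<in> W)"

definition irreducible_subrep ::
    "('g, 'm) monoid_scheme \<Rightarrow> ('g \<Rightarrow> 'n::finite cop \<Rightarrow> 'n cop) \<Rightarrow> 'n cop set \<Rightarrow> bool" where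
  "irreducible_subrep G \<rho> W \<longleftrightarrow> invariant_subspace G \<rho> W \<and> W \<noteq> {0} \<and>
     (\<forall>U. invariant_subspace G \<rho> U \<and> U \<subseteq> W \<longrightarrow> U = {0} \<or> U = W)"

definition isomorphic_subreps ::
    "('g, 'm) monoid_scheme \<Rightarrow> ('g \<Rightarrow> 'n::finite cop \<Rightarrow> 'n cop) \<Rightarrow> 'n cop set \<Rightarrow> 'n cop set \<Rightarrow> bool"
  where
  "isomorphic_subreps G \<rho> V W \<longleftrightarrow> (\<exists>f. bij_betw f V W \<and>
     (\<forall>X\<in>V. \<forall>Y\<in>V. f (X + Y) = f X + f Y) \<and>
     (\<forall>c. \<forall>X\<in>V. f (cscale c X) = cscale c (f X)) \<and>
     (\<forall>g\<in>carrier G. \<forall>X\<in>V. f (\<rho> g X) = \<rho> g (f X)))"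

text \<open>
  The space of all operators is a direct sum of pairwise non-isomorphic irreducible
  subrepresentations.
\<close>

definition multiplicity_free ::
    "('g, 'm) monoid_scheme \<Rightarrow> ('g \<Rightarrow> 'n::finite cop \<Rightarrow> 'n cop) \<Rightarrow> bool" where
  "multiplicity_free G \<rho> \<longleftrightarrow> (\<exists>\<W>. finite \<W> \<and>
     (\<forall>W\<in>\<W>. irreducible_subrep G \<rho> W) \<and>
     (\<forall>X. \<exists>!f. f \<in> (\<Pi>\<^sub>E W\<in>\<W>. W) \<and> X = (\<Sum>W\<in>\<W>. f W)) \<and>
     (\<forall>V\<in>\<W>. \<forall>W\<in>\<W>. V \<noteq> W \<longrightarrow> \<not> isomorphic_subreps G \<rho> V W))"

definition two_homogeneous ::
    "('g, 'm) monoid_scheme \<Rightarrow> ('g \<Rightarrow> 'n::finite cop \<Rightarrow> 'n cop) \<Rightarrow> 'n cop set \<Rightarrow> nat \<Rightarrow> bool" where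
  "two_homogeneous G \<rho> S r \<longleftrightarrow> (\<forall>t\<le>r. irreducible_subrep G \<rho> (layer S t))"

definition self_dual_via ::
    "('g, 'm) monoid_scheme \<Rightarrow> ('g \<Rightarrow> 'n::finite cop) \<Rightarrow> 'n cop \<Rightarrow> bool" where
  "self_dual_via G R \<Lambda> \<longleftrightarrow> unitary \<Lambda> \<and>
     (\<forall>g\<in>carrier G. \<Lambda> ** conj_mat (R g) ** adj_mat \<Lambda> = R g)"


subsection \<open>Superoperators\<close>

definition sup_Phi :: "'n::finite cop set \<Rightarrow> 'n cop \<Rightarrow> 'n cop" where
  "sup_Phi B X = (\<Sum>E\<in>B. E ** X ** adj_mat E)"

definition sup_Pi :: "'n::finite cop set \<Rightarrow> 'n cop \<Rightarrow> 'n cop" where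
  "sup_Pi B X = (\<Sum>E\<in>B. cscale (trace (adj_mat E ** X)) E)"

definition sup_T :: "'n::finite cop \<Rightarrow> 'n cop \<Rightarrow> 'n cop" where
  "sup_T \<Lambda> X = \<Lambda> ** conj_mat X ** adj_mat \<Lambda>"

text \<open>
  \<open>is_expansion B r \<Psi> w\<close>: as maps on self-adjoint operators, \<open>\<Psi>\<close> is the real linear combination
  of the projections \<open>sup_Pi (B j)\<close>, \<open>j \<le> r\<close>, with coefficients \<open>w j\<close>. Setting \<open>w j = 0\<close> for
  \<open>j > r\<close> makes the coefficient function unique.
\<close>

definition is_expansion ::
    "(nat \<Rightarrow> 'n::finite cop set) \<Rightarrow> nat \<Rightarrow> ('n cop \<Rightarrow> 'n cop) \<Rightarrow> (nat \<Rightarrow> real) \<Rightarrow> bool" where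
  "is_expansion B r \<Psi> w \<longleftrightarrow> (\<forall>j>r. w j = 0) \<and>
     (\<forall>X. self_adjoint X \<longrightarrow> \<Psi> X = (\<Sum>j\<le>r. w j *\<^sub>R sup_Pi (B j) X))"

definition expansion_coeffs ::
    "(nat \<Rightarrow> 'n::finite cop set) \<Rightarrow> nat \<Rightarrow> ('n cop \<Rightarrow> 'n cop) \<Rightarrow> nat \<Rightarrow> real" where
  "expansion_coeffs B r \<Psi> = (THE w. is_expansion B r \<Psi> w)"

definition W_coeff :: "(nat \<Rightarrow> 'n::finite cop set) \<Rightarrow> nat \<Rightarrow> nat \<Rightarrow> nat \<Rightarrow> real" where
  "W_coeff B r t = expansion_coeffs B r (sup_Phi (B t))"

definition T_coeff :: "(nat \<Rightarrow> 'n::finite cop set) \<Rightarrow> nat \<Rightarrow> 'n cop \<Rightarrow> nat \<Rightarrow> real" where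
  "T_coeff B r \<Lambda> = expansion_coeffs B r (sup_T \<Lambda>)"


subsection \<open>Quantum codes\<close>

definition is_orth_proj :: "'n::finite cop \<Rightarrow> (complex ^ 'n) set \<Rightarrow> bool" where
  "is_orth_proj P C \<longleftrightarrow> self_adjoint P \<and> P ** P = P \<and> range ((*v) P) = C"

text \<open>
  The trace below is real, since \<open>P\<close> is self-adjoint and the layers are closed under adjoints.
  For the zero code, where the quotient is undefined, division by zero yields \<open>0\<close>.
\<close>

definition distance_distribution ::
    "'n::finite cop set \<Rightarrow> (complex ^ 'n) set \<Rightarrow> 'n cop \<Rightarrow> real" where
  "distance_distribution B C P =
     real CARD('n) / real (vec.dim C) * Re (trace (P ** sup_Pi B P))"

end

theory Submission
  imports Defs "HOL-Computational_Algebra.Fundamental_Theorem_Algebra"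
begin

text \<open>
  Multiplicity-freeness and Schur's lemma make every equivariant superoperator act on each layer
  by a scalar, so \<open>\<Phi>\<^sub>t\<close> and \<open>\<T>\<close> are diagonal in the projections \<open>\<Pi>\<^sub>j\<close> and the sum in question is a
  non-negative multiple of \<open>tr (P \<Phi>\<^sub>t(\<T>(P)))\<close>. As \<open>Q = \<T>(P)\<close> is again an orthogonal
  projection, this trace is the sum of the squared norms of the operators \<open>P E Q\<close>, where \<open>E\<close> runs
  through an orthonormal basis of the \<open>t\<close>-th layer.
\<close>


subsection \<open>Matrix algebra\<close>

text \<open>Three mismatches shape the argument. Multiplicity-freeness supplies some decomposition
  into irreducibles whose members are not known to be the layers, so it must be shown that every
  irreducible invariant subspace is a member. Schur's lemma needs complex-linear maps, while
  \<open>sup_T\<close> is conjugate-linear on all operators. It is therefore replaced by the linear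
  map sending X to \<open>sup_T \<Lambda> (adj_mat X)\<close>, which agrees with it on self-adjoint
  operators, the only place where the expansion is asserted. Finally, Schur's lemma yields complex
  scalars, and the coefficients have to be real: this follows because both superoperators commute
  with adjoints and the layers are closed under adjoints. As the coefficients are given by a
  definite description, the expansions found this way also have to be unique.\<close>

lemma cscale_nth [simp]: "cscale c A $ i $ j = c * A $ i $ j"
  by (simp add: cscale_def)

lemma adj_mat_nth [simp]: "adj_mat A $ i $ j = cnj (A $ j $ i)"
  by (simp add: adj_mat_def conj_mat_def transpose_def)

lemma conj_mat_nth [simp]: "conj_mat A $ i $ j = cnj (A $ i $ j)"
  by (simp add: conj_mat_def)

lemma scaleR_eq_cscale: "a *\<^sub>R A = cscale (complex_of_real a) A"
  by (simp add: vec_eq_iff) (simp add: scaleR_conv_of_real)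

lemma adj_mat_adj_mat [simp]: "adj_mat (adj_mat A) = A"
  by (simp add: vec_eq_iff)

lemma adj_mat_add: "adj_mat (A + B) = adj_mat A + adj_mat B"
  by (simp add: vec_eq_iff)

lemma adj_mat_cscale: "adj_mat (cscale c A) = cscale (cnj c) (adj_mat A)"
  by (simp add: vec_eq_iff)

lemma adj_mat_zero [simp]: "adj_mat 0 = 0"
  by (simp add: vec_eq_iff)

lemma adj_mat_eq_0_iff [simp]: "adj_mat A = 0 \<longleftrightarrow> A = 0"
  by (metis adj_mat_adj_mat adj_mat_zero)

lemma adj_mat_mat1 [simp]: "adj_mat (mat 1) = mat 1"
  by (auto simp: vec_eq_iff mat_def)

lemma adj_mat_mult: "adj_mat (A ** B) = adj_mat B ** adj_mat A"
  by (simp add: vec_eq_iff matrix_matrix_mult_def mult.commute)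

lemma conj_mat_mult: "conj_mat (A ** B) = conj_mat A ** conj_mat B"
  by (simp add: vec_eq_iff matrix_matrix_mult_def)

lemma adj_mat_sum: "adj_mat (\<Sum>i\<in>I. f i) = (\<Sum>i\<in>I. adj_mat (f i))"
  by (induction I rule: infinite_finite_induct) (simp_all add: adj_mat_add)

lemma matrix_add_rdistrib: "(A + B) ** C = A ** C + B ** (C :: 'a::semiring_1 ^ 'n ^ 'm)"
  by (simp add: vec_eq_iff matrix_matrix_mult_def sum.distrib algebra_simps)

lemma matrix_mul_zero_left [simp]: "(0 :: 'a::semiring_1 ^ 'n ^ 'm) ** C = 0"
  by (simp add: vec_eq_iff matrix_matrix_mult_def)

lemma matrix_mul_zero_right [simp]: "C ** (0 :: 'a::semiring_1 ^ 'n ^ 'm) = 0"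
  by (simp add: vec_eq_iff matrix_matrix_mult_def)

lemma matrix_sum_ldistrib: "A ** (\<Sum>i\<in>I. f i) = (\<Sum>i\<in>I. A ** (f i :: 'a::semiring_1 ^ 'n ^ 'm))"
  by (induction I rule: infinite_finite_induct) (simp_all add: matrix_add_ldistrib)

lemma matrix_sum_rdistrib: "(\<Sum>i\<in>I. f i) ** A = (\<Sum>i\<in>I. (f i :: 'a::semiring_1 ^ 'n ^ 'm) ** A)"
  by (induction I rule: infinite_finite_induct) (simp_all add: matrix_add_rdistrib)

lemma cscale_mult_left: "cscale c A ** B = cscale c (A ** B)"
  by (simp add: vec_eq_iff matrix_matrix_mult_def sum_distrib_left mult.assoc)

lemma cscale_mult_right: "A ** cscale c B = cscale c (A ** B)"
  by (simp add: vec_eq_iff matrix_matrix_mult_def sum_distrib_left ac_simps)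

lemma trace_cscale: "trace (cscale c A) = c * trace A"
  by (simp add: trace_def sum_distrib_left)

lemma trace_sum: "trace (\<Sum>i\<in>I. f i :: 'a::comm_semiring_1 ^ 'n ^ 'n) = (\<Sum>i\<in>I. trace (f i))"
  by (induction I rule: infinite_finite_induct) (simp_all add: trace_def sum.distrib)


subsection \<open>The Hilbert--Schmidt inner product\<close>

lemma hs_inner_add_right: "hs_inner E (F + F') = hs_inner E F + hs_inner E F'"
  by (simp add: hs_inner_def matrix_add_ldistrib trace_add)

lemma hs_inner_add_left: "hs_inner (E + E') F = hs_inner E F + hs_inner E' F"
  by (simp add: hs_inner_def adj_mat_add matrix_add_rdistrib trace_add)

lemma hs_inner_cscale_right: "hs_inner E (cscale c F) = c * hs_inner E F"
  by (simp add: hs_inner_def cscale_mult_right trace_cscale)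

lemma hs_inner_cscale_left: "hs_inner (cscale c E) F = cnj c * hs_inner E F"
  by (simp add: hs_inner_def adj_mat_cscale cscale_mult_left trace_cscale)

lemma hs_inner_zero [simp]: "hs_inner 0 F = 0" "hs_inner E 0 = 0"
  by (simp_all add: hs_inner_def trace_0[unfolded mat_0])

lemma hs_inner_sum_right: "hs_inner E (\<Sum>i\<in>I. f i) = (\<Sum>i\<in>I. hs_inner E (f i))"
  by (induction I rule: infinite_finite_induct) (simp_all add: hs_inner_add_right)

lemma hs_inner_sum_left: "hs_inner (\<Sum>i\<in>I. f i) F = (\<Sum>i\<in>I. hs_inner (f i) F)"
  by (induction I rule: infinite_finite_induct) (simp_all add: hs_inner_add_left)

lemma hs_inner_diff_right: "hs_inner E (F - F') = hs_inner E F - hs_inner E F'"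
  using hs_inner_add_right[of E "F - F'" F'] by simp

lemma hs_inner_commute: "hs_inner F E = cnj (hs_inner E F)"
  by (simp add: hs_inner_def trace_def matrix_matrix_mult_def mult.commute)

lemma hs_inner_adj: "hs_inner E (adj_mat F) = cnj (hs_inner (adj_mat E) F)"
proof -
  have "hs_inner E (adj_mat F) = trace (adj_mat F ** adj_mat E)"
    unfolding hs_inner_def by (rule trace_mul_sym)
  also have "\<dots> = cnj (hs_inner (adj_mat E) F)"
    by (subst hs_inner_commute[symmetric]) (simp add: hs_inner_def)
  finally show ?thesis .
qed

lemma hs_inner_self: "hs_inner E E = of_real (\<Sum>i\<in>UNIV. \<Sum>k\<in>UNIV. (cmod (E $ k $ i))\<^sup>2)"
  unfolding of_real_sum complex_norm_square
  by (simp add: hs_inner_def trace_def matrix_matrix_mult_def mult.commute)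

lemma Re_hs_inner_self_nonneg: "Re (hs_inner E E) \<ge> 0"
  by (simp add: hs_inner_self sum_nonneg)

lemma hs_inner_conjugate:
  assumes "U ** adj_mat U = mat 1"
  shows "hs_inner (adj_mat U ** E ** U) (adj_mat U ** F ** U) = hs_inner E F"
proof -
  have "hs_inner (adj_mat U ** E ** U) (adj_mat U ** F ** U)
      = trace (adj_mat U ** (adj_mat E ** (U ** adj_mat U) ** F ** U))"
    by (simp only: hs_inner_def adj_mat_mult adj_mat_adj_mat matrix_mul_assoc)
  also have "\<dots> = trace (adj_mat E ** F ** (U ** adj_mat U))"
    by (subst trace_mul_sym) (simp only: assms matrix_mul_rid matrix_mul_lid matrix_mul_assoc[symmetric])
  also have "\<dots> = hs_inner E F"
    by (simp add: hs_inner_def assms)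
  finally show ?thesis .
qed


subsection \<open>Eigenvectors of linear superoperators\<close>

abbreviation op_linear :: "('n::finite cop \<Rightarrow> 'n cop) \<Rightarrow> bool" where
  "op_linear \<equiv> module_hom cscale cscale"

lemma op_linear_iff:
  "op_linear \<Psi> \<longleftrightarrow> (\<forall>X Y. \<Psi> (X + Y) = \<Psi> X + \<Psi> Y) \<and> (\<forall>c X. \<Psi> (cscale c X) = cscale c (\<Psi> X))"
  by (auto simp: module_hom_iff cop.module_axioms)

lemma op_linearI:
  assumes "\<And>X Y. \<Psi> (X + Y) = \<Psi> X + \<Psi> Y" "\<And>c X. \<Psi> (cscale c X) = cscale c (\<Psi> X)"
  shows "op_linear \<Psi>"
  using assms by (simp add: op_linear_iff)

text \<open>A real linear relation is in particular a complex one, so the real dimension bounds the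
  length of an independent sequence. Dependence is a property of sets, which is why a repeated value
  is treated apart, with the relation \<open>x i - x j = 0\<close>.\<close>

lemma sequence_dependent:
  fixes x :: "nat \<Rightarrow> 'n::finite cop"
  obtains N c where "(\<Sum>i\<le>N. cscale (c i) (x i)) = 0" "\<exists>i\<le>N. c i \<noteq> 0"
proof -
  define N where "N = DIM('n cop)"
  show thesis
  proof (cases "inj_on x {..N}")
    case True
    then have "card (x ` {..N}) = Suc N"
      by (simp add: card_image)
    then have "dependent (x ` {..N})"
      using independent_bound[of "x ` {..N}"] by (auto simp: N_def)
    then obtain u where u: "\<exists>v\<in>x ` {..N}. u v \<noteq> 0" "(\<Sum>v\<in>x ` {..N}. u v *\<^sub>R v) = 0"
      by (auto simp: real_vector.dependent_finite)
    have "(\<Sum>i\<le>N. cscale (complex_of_real (u (x i))) (x i)) = (\<Sum>v\<in>x ` {..N}. u v *\<^sub>R v)"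
      by (simp add: sum.reindex[OF True] scaleR_eq_cscale)
    then show thesis
      using u by (intro that[where N = N and c = "\<lambda>i. complex_of_real (u (x i))"]) auto
  next
    case False
    then obtain i j where ij: "i \<le> N" "j \<le> N" "i \<noteq> j" "x i = x j"
      by (auto simp: inj_on_def)
    define c where "c k = (if k = i then 1 else 0) - (if k = j then 1 else (0::complex))" for k
    have "(\<Sum>k\<le>N. cscale (c k) (x k))
        = (\<Sum>k\<le>N. (if k = i then x k else 0) - (if k = j then x k else 0))"
      by (rule sum.cong) (auto simp: c_def cop.scale_left_diff_distrib)
    also have "\<dots> = x i - x j"
      using ij by (simp add: sum_subtractf)
    finally show thesis
      using ij by (intro that[where N = N and c = c]) (auto simp: c_def)
  qed
qed

text \<open>This is the polynomial p evaluated at \<Psi>, applied to the single vector X.\<close>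

definition poly_act :: "('n::finite cop \<Rightarrow> 'n cop) \<Rightarrow> complex poly \<Rightarrow> 'n cop \<Rightarrow> 'n cop" where
  "poly_act \<Psi> p X = (\<Sum>i\<le>degree p. cscale (coeff p i) ((\<Psi> ^^ i) X))"

lemma poly_act_bound:
  assumes "degree p \<le> N"
  shows "poly_act \<Psi> p X = (\<Sum>i\<le>N. cscale (coeff p i) ((\<Psi> ^^ i) X))"
  unfolding poly_act_def
  by (rule sum.mono_neutral_left) (use assms in \<open>auto simp: coeff_eq_0\<close>)

text \<open>Splitting off a root c of p turns p(\<Psi>) into \<Psi> - c applied after q(\<Psi>).
  Multiplication by the indeterminate is the coefficient shift \<open>pCons 0 q\<close>, which costs
  one more application of \<Psi>.\<close>

lemma poly_act_linear_factor:
  assumes "op_linear \<Psi>"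
  shows "poly_act \<Psi> ([:- c, 1:] * q) X = \<Psi> (poly_act \<Psi> q X) - cscale c (poly_act \<Psi> q X)"
proof -
  interpret module_hom cscale cscale \<Psi> by fact
  let ?N = "Suc (degree q)"
  have "[:- c, 1:] * q = pCons 0 q - smult c q"
    by simp
  moreover have "degree (pCons 0 q - smult c q) \<le> ?N"
    by (meson degree_diff_le degree_pCons_le degree_smult_le le_SucI order_trans)
  ultimately have "poly_act \<Psi> ([:- c, 1:] * q) X
      = (\<Sum>i\<le>?N. cscale (coeff (pCons 0 q) i) ((\<Psi> ^^ i) X))
        - (\<Sum>i\<le>?N. cscale c (cscale (coeff q i) ((\<Psi> ^^ i) X)))"
    by (simp only: poly_act_bound coeff_diff coeff_smult cop.scale_left_diff_distrib sum_subtractf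
        cop.scale_scale)
  also have "(\<Sum>i\<le>?N. cscale c (cscale (coeff q i) ((\<Psi> ^^ i) X))) = cscale c (poly_act \<Psi> q X)"
    by (subst poly_act_bound[of _ ?N]) (simp_all only: cop.scale_sum_right le_SucI order_refl)
  also have "(\<Sum>i\<le>?N. cscale (coeff (pCons 0 q) i) ((\<Psi> ^^ i) X)) = \<Psi> (poly_act \<Psi> q X)"
    by (subst sum.atMost_Suc_shift) (simp add: poly_act_def sum scale)
  finally show ?thesis .
qed

lemma poly_act_subspace:
  assumes "cop.subspace V" "\<And>Y. Y \<in> V \<Longrightarrow> \<Psi> Y \<in> V" "X \<in> V"
  shows "poly_act \<Psi> p X \<in> V"
proof -
  have "(\<Psi> ^^ i) X \<in> V" for i
    by (induction i) (use assms in auto)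
  then show ?thesis
    unfolding poly_act_def by (intro cop.subspace_sum cop.subspace_scale assms(1))
qed

text \<open>The iterates of X are linearly dependent, so some nonzero polynomial p satisfies
  p(\<Psi>) X = 0. Its linear factors are removed until the value is no longer zero; that value is
  an eigenvector, and it lies in V because V is stable under \<Psi>.\<close>

lemma eigenvector_exists:
  assumes "op_linear \<Psi>" "cop.subspace V" "\<And>Y. Y \<in> V \<Longrightarrow> \<Psi> Y \<in> V" "X \<in> V" "X \<noteq> 0"
  obtains c Y where "Y \<in> V" "Y \<noteq> 0" "\<Psi> Y = cscale c Y"
proof -
  obtain N a where a: "(\<Sum>i\<le>N. cscale (a i) ((\<Psi> ^^ i) X)) = 0" "\<exists>i\<le>N. a i \<noteq> 0"
    by (rule sequence_dependent)
  define p where "p = (\<Sum>i\<le>N. monom (a i) i)"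
  have coeff_p: "coeff p i = (if i \<le> N then a i else 0)" for i
    by (simp add: p_def coeff_sum)
  have "degree p \<le> N"
    by (rule degree_le) (simp add: coeff_p)
  then have "poly_act \<Psi> p X = 0"
    using a(1) by (simp add: poly_act_bound[of _ N] coeff_p)
  moreover have "p \<noteq> 0"
    using a(2) coeff_p by (metis coeff_0)
  ultimately have "\<exists>c Y. Y \<in> V \<and> Y \<noteq> 0 \<and> \<Psi> Y = cscale c Y"
  \<comment> \<open>With p = (x - c) q, either q(\<Psi>) X vanishes and q is a smaller annihilating
    polynomial, or q(\<Psi>) X is an eigenvector for c.\<close>
  proof (induction "degree p" arbitrary: p rule: less_induct)
    case less
    have "degree p \<noteq> 0"
    proof
      assume "degree p = 0"
      then have "cscale (coeff p 0) X = 0"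
        using less.prems by (simp add: poly_act_def)
      then show False
        using assms(5) less.prems(2) \<open>degree p = 0\<close> by (metis cop.scale_eq_0_iff leading_coeff_0_iff)
    qed
    then have "\<not> constant (poly p)"
      by (simp add: constant_degree)
    then obtain c where "poly p c = 0"
      using fundamental_theorem_of_algebra by blast
    then obtain q where q: "p = [:- c, 1:] * q"
      unfolding poly_eq_0_iff_dvd by (elim dvdE)
    have "q \<noteq> 0"
      using q less.prems by auto
    then have "degree q < degree p"
      unfolding q by (subst degree_mult_eq) auto
    show ?case
    proof (cases "poly_act \<Psi> q X = 0")
      case True
      then show ?thesis
        using less.hyps \<open>degree q < degree p\<close> \<open>q \<noteq> 0\<close> by blast
    next
      case False
      have "\<Psi> (poly_act \<Psi> q X) = cscale c (poly_act \<Psi> q X)"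
        using less.prems(1) unfolding q poly_act_linear_factor[OF assms(1)]
        by (simp only: right_minus_eq)
      with False show ?thesis
        using poly_act_subspace[OF assms(2), of \<Psi>, OF assms(3,4)] by blast
    qed
  qed
  then show thesis
    using that by blast
qed


subsection \<open>Schur's lemma for multiplicity-free representations\<close>

definition equivariant ::
    "('g, 'm) monoid_scheme \<Rightarrow> ('g \<Rightarrow> 'n::finite cop \<Rightarrow> 'n cop) \<Rightarrow> ('n cop \<Rightarrow> 'n cop) \<Rightarrow> bool" where
  "equivariant G \<rho> f \<longleftrightarrow> (\<forall>g\<in>carrier G. \<forall>X. f (\<rho> g X) = \<rho> g (f X))"

lemma isomorphic_subreps_sym:
  assumes "invariant_subspace G \<rho> V" "isomorphic_subreps G \<rho> V W"
  shows "isomorphic_subreps G \<rho> W V"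
proof -
  obtain f where bij: "bij_betw f V W"
    and f: "\<forall>X\<in>V. \<forall>Y\<in>V. f (X + Y) = f X + f Y" "\<forall>c. \<forall>X\<in>V. f (cscale c X) = cscale c (f X)"
      "\<forall>g\<in>carrier G. \<forall>X\<in>V. f (\<rho> g X) = \<rho> g (f X)"
    using assms(2) unfolding isomorphic_subreps_def by auto
  have V: "cop.subspace V" "\<And>g X. g \<in> carrier G \<Longrightarrow> X \<in> V \<Longrightarrow> \<rho> g X \<in> V"
    using assms(1) by (auto simp: invariant_subspace_def)
  define h where "h = inv_into V f"
  have h: "h (f X) = X" if "X \<in> V" for X
    using bij that by (simp add: h_def bij_betw_def)
  have W: "W = f ` V"
    using bij by (simp add: bij_betw_def)
  show ?thesis
    unfolding isomorphic_subreps_def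
  proof (intro exI[of _ h] conjI)
    show "bij_betw h W V"
      unfolding h_def by (rule bij_betw_inv_into[OF bij])
    show "\<forall>X\<in>W. \<forall>Y\<in>W. h (X + Y) = h X + h Y"
      unfolding W using f(1) h V(1) by (auto simp: cop.subspace_add simp flip: f(1)[rule_format])
    show "\<forall>c. \<forall>X\<in>W. h (cscale c X) = cscale c (h X)"
      unfolding W using h V(1) by (auto simp: cop.subspace_scale simp flip: f(2)[rule_format])
    show "\<forall>g\<in>carrier G. \<forall>X\<in>W. h (\<rho> g X) = \<rho> g (h X)"
      unfolding W using h V(2) by (auto simp flip: f(3)[rule_format])
  qed
qed

lemma isomorphic_subreps_trans:
  assumes "isomorphic_subreps G \<rho> U V" "isomorphic_subreps G \<rho> V W"
  shows "isomorphic_subreps G \<rho> U W"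
proof -
  obtain f where bij1: "bij_betw f U V"
    and f: "\<forall>X\<in>U. \<forall>Y\<in>U. f (X + Y) = f X + f Y" "\<forall>c. \<forall>X\<in>U. f (cscale c X) = cscale c (f X)"
      "\<forall>g\<in>carrier G. \<forall>X\<in>U. f (\<rho> g X) = \<rho> g (f X)"
    using assms(1) unfolding isomorphic_subreps_def by auto
  obtain h where bij2: "bij_betw h V W"
    and h: "\<forall>X\<in>V. \<forall>Y\<in>V. h (X + Y) = h X + h Y" "\<forall>c. \<forall>X\<in>V. h (cscale c X) = cscale c (h X)"
      "\<forall>g\<in>carrier G. \<forall>X\<in>V. h (\<rho> g X) = \<rho> g (h X)"
    using assms(2) unfolding isomorphic_subreps_def by auto
  have "\<And>X. X \<in> U \<Longrightarrow> f X \<in> V"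
    using bij1 by (auto simp: bij_betw_def)
  then show ?thesis
    unfolding isomorphic_subreps_def
    by (intro exI[of _ "h \<circ> f"] conjI bij_betw_trans[OF bij1 bij2]) (simp_all add: f h)
qed

text \<open>The first half of Schur's lemma. The kernel of f in V is invariant and misses X, so it
  is zero and f is injective on V. An invariant subspace of the image pulls back to an invariant
  subspace of V, which leaves only the two trivial possibilities.\<close>

lemma irreducible_image:
  assumes irr: "irreducible_subrep G \<rho> V" and lin: "op_linear f" and eqv: "equivariant G \<rho> f"
    and \<rho>: "\<And>g. g \<in> carrier G \<Longrightarrow> op_linear (\<rho> g)"
    and X: "X \<in> V" "f X \<noteq> 0"
  shows "irreducible_subrep G \<rho> (f ` V)" "isomorphic_subreps G \<rho> V (f ` V)"
proof -
  interpret f: module_hom cscale cscale f by fact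
  have V: "cop.subspace V" "\<And>g X. g \<in> carrier G \<Longrightarrow> X \<in> V \<Longrightarrow> \<rho> g X \<in> V"
    and min: "\<And>U. invariant_subspace G \<rho> U \<Longrightarrow> U \<subseteq> V \<Longrightarrow> U = {0} \<or> U = V"
    using irr unfolding irreducible_subrep_def invariant_subspace_def by auto
  have eqv': "f (\<rho> g Y) = \<rho> g (f Y)" if "g \<in> carrier G" for g Y
    using eqv that by (simp add: equivariant_def)
  \<comment> \<open>Used twice: for the zero subspace it gives the kernel, for a general U the
    irreducibility of the image.\<close>
  have preimage: "invariant_subspace G \<rho> {Y \<in> V. f Y \<in> U}" if "invariant_subspace G \<rho> U" for U
  proof -
    have U: "cop.subspace U" "\<And>g X. g \<in> carrier G \<Longrightarrow> X \<in> U \<Longrightarrow> \<rho> g X \<in> U"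
      using that by (auto simp: invariant_subspace_def)
    show ?thesis
      unfolding invariant_subspace_def
      using U V by (auto simp: eqv' f.add f.scale cop.subspace_def)
  qed
  have "\<rho> g 0 = 0" if "g \<in> carrier G" for g
    using module_hom.zero[OF \<rho>[OF that]] .
  then have "invariant_subspace G \<rho> {0}"
    by (auto simp: invariant_subspace_def cop.subspace_single_0)
  from min[OF preimage[OF this]] X have "{Y \<in> V. f Y \<in> {0}} = {0}"
    by blast
  then have inj: "inj_on f V"
    unfolding f.inj_on_iff_eq_0[OF V(1)] by blast
  show "isomorphic_subreps G \<rho> V (f ` V)"
    unfolding isomorphic_subreps_def
    by (intro exI[of _ f]) (use inj in \<open>simp add: bij_betw_def f.add f.scale eqv'\<close>)
  show "irreducible_subrep G \<rho> (f ` V)"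
    unfolding irreducible_subrep_def
  proof (intro conjI allI impI)
    show "invariant_subspace G \<rho> (f ` V)"
      unfolding invariant_subspace_def using V(2)
      by (auto intro: f.subspace_image[OF V(1)] simp flip: eqv')
    show "f ` V \<noteq> {0}"
      using X by blast
    fix U assume U: "invariant_subspace G \<rho> U \<and> U \<subseteq> f ` V"
    then have *: "U = f ` {Y \<in> V. f Y \<in> U}"
      by blast
    consider "{Y \<in> V. f Y \<in> U} = {0}" | "{Y \<in> V. f Y \<in> U} = V"
      using min[OF preimage] U by blast
    then show "U = {0} \<or> U = f ` V"
    proof cases
      case 1 show ?thesis by (subst (1) *, subst 1) simp
    next
      case 2 then show ?thesis using * by simp
    qed
  qed
qed

text \<open>These are the projections belonging to the direct sum. Linearity and equivariance come
  from uniqueness: the candidate components of a sum, a multiple or a translate lie in the right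
  subspaces and add up correctly.\<close>

lemma component_maps:
  assumes "finite \<W>" and inv: "\<And>W. W \<in> \<W> \<Longrightarrow> invariant_subspace G \<rho> W"
    and \<rho>: "\<And>g. g \<in> carrier G \<Longrightarrow> op_linear (\<rho> g)"
    and uniq: "\<forall>X. \<exists>!f. f \<in> (\<Pi>\<^sub>E W\<in>\<W>. W) \<and> X = (\<Sum>W\<in>\<W>. f W)"
  obtains p where "\<And>W. W \<in> \<W> \<Longrightarrow> op_linear (p W)" "\<And>W. W \<in> \<W> \<Longrightarrow> equivariant G \<rho> (p W)"
    "\<And>W X. W \<in> \<W> \<Longrightarrow> p W X \<in> W" "\<And>X. X = (\<Sum>W\<in>\<W>. p W X)"
proof -
  have sub: "cop.subspace W" if "W \<in> \<W>" for W
    using inv[OF that] by (simp add: invariant_subspace_def)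
  obtain F where F: "\<And>X. F X \<in> (\<Pi>\<^sub>E W\<in>\<W>. W)" "\<And>X. X = (\<Sum>W\<in>\<W>. F X W)"
    using uniq by metis
  have F_mem: "F X W \<in> W" if "W \<in> \<W>" for X W
    using F(1)[of X] that by auto
  have F_eq: "F X W = h W" if "W \<in> \<W>" "\<And>W. W \<in> \<W> \<Longrightarrow> h W \<in> W" "X = (\<Sum>W\<in>\<W>. h W)" for X h W
  proof -
    \<comment> \<open>The functions in the uniqueness statement are extensional, so h is cut down to
      \<W> before it is compared.\<close>
    have "restrict h \<W> \<in> (\<Pi>\<^sub>E W\<in>\<W>. W)" "X = (\<Sum>W\<in>\<W>. restrict h \<W> W)"
      using that by auto
    then have "F X = restrict h \<W>"
      using uniq[rule_format, of X] F[of X] by (elim ex1E) metis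
    then show ?thesis
      using that by simp
  qed
  show thesis
  proof (rule that[of "\<lambda>W X. F X W"])
    fix W assume W: "W \<in> \<W>"
    show "op_linear (\<lambda>X. F X W)"
    proof (rule op_linearI)
      show "F (X + Y) W = F X W + F Y W" for X Y
        by (rule F_eq[OF W, where h = "\<lambda>W. F X W + F Y W"])
          (auto simp: sum.distrib F_mem cop.subspace_add[OF sub] simp flip: F(2))
      show "F (cscale c X) W = cscale c (F X W)" for c X
        by (rule F_eq[OF W, where h = "\<lambda>W. cscale c (F X W)"])
          (auto simp: F_mem cop.subspace_scale[OF sub] simp flip: F(2) cop.scale_sum_right)
    qed
    show "equivariant G \<rho> (\<lambda>X. F X W)"
      unfolding equivariant_def
    proof (intro ballI allI)
      fix g X assume g: "g \<in> carrier G"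
      interpret module_hom cscale cscale "\<rho> g" by (rule \<rho>[OF g])
      show "F (\<rho> g X) W = \<rho> g (F X W)"
      proof (rule F_eq[OF W, where h = "\<lambda>W. \<rho> g (F X W)"])
        show "\<rho> g (F X W) \<in> W" if "W \<in> \<W>" for W
          using inv[OF that] F_mem[OF that] g by (auto simp: invariant_subspace_def)
        show "\<rho> g X = (\<Sum>W\<in>\<W>. \<rho> g (F X W))"
          by (simp flip: sum F(2))
      qed
    qed
  qed (use F_mem F(2) in auto)
qed

text \<open>By Schur's lemma each component map is zero on V or carries V isomorphically onto its
  member W. Two nonzero ones would make two distinct members isomorphic, so exactly one survives on
  V. Since the components add up to the identity, that one is the identity on V, whence V =
  W.\<close>

lemma irreducible_mem_decomposition:
  assumes "finite \<W>" and irr: "\<And>W. W \<in> \<W> \<Longrightarrow> irreducible_subrep G \<rho> W"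
    and \<rho>: "\<And>g. g \<in> carrier G \<Longrightarrow> op_linear (\<rho> g)"
    and uniq: "\<forall>X. \<exists>!f. f \<in> (\<Pi>\<^sub>E W\<in>\<W>. W) \<and> X = (\<Sum>W\<in>\<W>. f W)"
    and non_iso: "\<And>V W. V \<in> \<W> \<Longrightarrow> W \<in> \<W> \<Longrightarrow> V \<noteq> W \<Longrightarrow> \<not> isomorphic_subreps G \<rho> V W"
    and V: "irreducible_subrep G \<rho> V"
  shows "V \<in> \<W>"
proof -
  have inv: "invariant_subspace G \<rho> W" if "W \<in> \<W>" for W
    using irr[OF that] by (simp add: irreducible_subrep_def)
  obtain p where p: "\<And>W. W \<in> \<W> \<Longrightarrow> op_linear (p W)" "\<And>W. W \<in> \<W> \<Longrightarrow> equivariant G \<rho> (p W)"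
    "\<And>W X. W \<in> \<W> \<Longrightarrow> p W X \<in> W" "\<And>X. X = (\<Sum>W\<in>\<W>. p W X)"
    using component_maps[OF assms(1) inv \<rho> uniq] by blast
  have V': "invariant_subspace G \<rho> V" "V \<noteq> {0}" "0 \<in> V"
    using V by (auto simp: irreducible_subrep_def invariant_subspace_def cop.subspace_0)
  have iso: "p W ` V = W \<and> isomorphic_subreps G \<rho> V W" if "W \<in> \<W>" "X \<in> V" "p W X \<noteq> 0" for W X
  proof -
    have img: "irreducible_subrep G \<rho> (p W ` V)" "isomorphic_subreps G \<rho> V (p W ` V)"
      using irreducible_image[OF V p(1,2) \<rho>] that by blast+
    moreover have "p W ` V \<subseteq> W"
      using p(3) that by blast
    ultimately have "p W ` V = W"
      using irr[OF that(1)] unfolding irreducible_subrep_def by metis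
    then show ?thesis
      using img by simp
  qed
  obtain X where X: "X \<in> V" "X \<noteq> 0"
    using V' by blast
  have "\<exists>W\<in>\<W>. p W X \<noteq> 0"
  proof (rule ccontr)
    assume "\<not> (\<exists>W\<in>\<W>. p W X \<noteq> 0)"
    then have "(\<Sum>W\<in>\<W>. p W X) = 0"
      by (intro sum.neutral) blast
    then show False
      using p(4)[of X] X(2) by simp
  qed
  then obtain W where W: "W \<in> \<W>" "p W X \<noteq> 0"
    by blast
  have "p W' Y = 0" if "W' \<in> \<W>" "W' \<noteq> W" "Y \<in> V" for W' Y
  proof (rule ccontr)
    assume "p W' Y \<noteq> 0"
    then have "isomorphic_subreps G \<rho> V W'" "isomorphic_subreps G \<rho> V W"
      using iso that W X by blast+
    then show False
      using non_iso[OF that(1) W(1) that(2)] isomorphic_subreps_sym[OF V'(1)]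
        isomorphic_subreps_trans by blast
  qed
  then have "p W Y = Y" if "Y \<in> V" for Y
    using p(4)[of Y] that sum.remove[OF assms(1) W(1), of "\<lambda>W. p W Y"] by simp
  then have "p W ` V = V"
    by simp
  then show ?thesis
    using iso[OF W(1) X(1) W(2)] W(1) by simp
qed

text \<open>The image of an irreducible subspace is zero or again a member of the decomposition, and in
  the latter case multiplicity-freeness forces it to be the subspace itself.\<close>

lemma multiplicity_free_scalar:
  assumes mf: "multiplicity_free G \<rho>" and irr: "irreducible_subrep G \<rho> V"
    and lin: "op_linear \<Psi>" and eqv: "equivariant G \<rho> \<Psi>"
    and \<rho>: "\<And>g. g \<in> carrier G \<Longrightarrow> op_linear (\<rho> g)"
  shows "\<exists>c. \<forall>X\<in>V. \<Psi> X = cscale c X"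
proof (cases "\<forall>X\<in>V. \<Psi> X = 0")
  case True
  then show ?thesis
    by (intro exI[of _ 0]) simp
next
  case False
  then obtain X where X: "X \<in> V" "\<Psi> X \<noteq> 0"
    by blast
  interpret \<Psi>: module_hom cscale cscale \<Psi> by fact
  have img: "irreducible_subrep G \<rho> (\<Psi> ` V)" "isomorphic_subreps G \<rho> V (\<Psi> ` V)"
    by (rule irreducible_image[OF irr lin eqv \<rho> X]; assumption)+
  obtain \<W> where W: "finite \<W>" "\<forall>W\<in>\<W>. irreducible_subrep G \<rho> W"
    "\<forall>X. \<exists>!f. f \<in> (\<Pi>\<^sub>E W\<in>\<W>. W) \<and> X = (\<Sum>W\<in>\<W>. f W)"
    "\<forall>V\<in>\<W>. \<forall>W\<in>\<W>. V \<noteq> W \<longrightarrow> \<not> isomorphic_subreps G \<rho> V W"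
    using mf unfolding multiplicity_free_def by (elim exE conjE) (rule that)
  have mem: "U \<in> \<W>" if "irreducible_subrep G \<rho> U" for U
    by (rule irreducible_mem_decomposition[OF W(1) W(2)[rule_format] \<rho> W(3)
          W(4)[rule_format] that])
  have "\<Psi> ` V = V"
    using mem[OF irr] mem[OF img(1)] W(4) img(2) by metis
  then have stable: "\<Psi> Y \<in> V" if "Y \<in> V" for Y
    using that by blast
  have V: "cop.subspace V" "\<And>g X. g \<in> carrier G \<Longrightarrow> X \<in> V \<Longrightarrow> \<rho> g X \<in> V"
    using irr unfolding irreducible_subrep_def invariant_subspace_def by auto
  have "X \<noteq> 0"
    using X by auto
  then obtain c Y where Y: "Y \<in> V" "Y \<noteq> 0" "\<Psi> Y = cscale c Y"
    using eigenvector_exists[OF lin V(1) stable X(1)] by blast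
  \<comment> \<open>The eigenspace is invariant because \<Psi> commutes with the action; it contains
    the nonzero Y, so irreducibility makes it all of V.\<close>
  let ?E = "{Y \<in> V. \<Psi> Y = cscale c Y}"
  have "\<rho> g Z \<in> ?E" if "g \<in> carrier G" "Z \<in> ?E" for g Z
    using that V(2) eqv module_hom.scale[OF \<rho>] by (simp add: equivariant_def)
  moreover have "cop.subspace ?E"
    using V(1) by (auto simp: cop.subspace_def \<Psi>.add \<Psi>.scale cop.scale_right_distrib mult.commute)
  ultimately have "invariant_subspace G \<rho> ?E"
    by (simp add: invariant_subspace_def)
  then have "?E = {0} \<or> ?E = V"
    using irr unfolding irreducible_subrep_def by blast
  then show ?thesis
    using Y by blast
qed


subsection \<open>Orthonormal bases\<close>

lemma onb_expansion:
  assumes "is_onb B V" "X \<in> V"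
  shows "X = (\<Sum>E\<in>B. cscale (hs_inner E X) E)"
proof -
  have "finite B" and X: "X \<in> cop.span B"
    and on: "\<And>E F. E \<in> B \<Longrightarrow> F \<in> B \<Longrightarrow> hs_inner E F = (if E = F then 1 else 0)"
    using assms by (auto simp: is_onb_def)
  obtain u where u: "X = (\<Sum>F\<in>B. cscale (u F) F)"
    using X unfolding cop.span_finite[OF \<open>finite B\<close>] by auto
  have "hs_inner E X = u E" if "E \<in> B" for E
    using \<open>finite B\<close> that
    by (simp add: u hs_inner_sum_right hs_inner_cscale_right on if_distrib cong: if_cong)
  then have "(\<Sum>E\<in>B. cscale (hs_inner E X) E) = (\<Sum>F\<in>B. cscale (u F) F)"
    by (intro sum.cong) auto
  then show ?thesis
    by (simp only: u)
qed

lemma sup_Pi_eq: "sup_Pi B X = (\<Sum>E\<in>B. cscale (hs_inner E X) E)"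
  by (simp add: sup_Pi_def hs_inner_def)

lemma sup_Pi_mem:
  assumes "is_onb B V"
  shows "sup_Pi B X \<in> V"
proof -
  have "V = cop.span B"
    using assms by (simp add: is_onb_def)
  then show ?thesis
    unfolding sup_Pi_eq by (auto intro: cop.span_sum cop.span_scale cop.span_base)
qed

lemma sup_Pi_of_mem: "is_onb B V \<Longrightarrow> X \<in> V \<Longrightarrow> sup_Pi B X = X"
  unfolding sup_Pi_eq by (rule onb_expansion[symmetric])

lemma sup_Pi_of_orthogonal: "is_onb B V \<Longrightarrow> (\<And>E. E \<in> V \<Longrightarrow> hs_inner E X = 0) \<Longrightarrow> sup_Pi B X = 0"
  unfolding sup_Pi_eq is_onb_def by (auto intro!: sum.neutral simp: cop.span_base)

lemma op_linear_sup_Pi: "op_linear (sup_Pi B)"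
  unfolding sup_Pi_eq
  by (rule op_linearI)
    (simp_all add: hs_inner_add_right hs_inner_cscale_right cop.scale_left_distrib sum.distrib
      cop.scale_sum_right)

lemma hs_inner_sup_Pi_left: "hs_inner (sup_Pi B X) Y = hs_inner X (sup_Pi B Y)"
  unfolding sup_Pi_eq hs_inner_sum_left hs_inner_sum_right hs_inner_cscale_left hs_inner_cscale_right
  by (rule sum.cong) (simp_all only: hs_inner_commute[symmetric] mult.commute)

lemma op_linear_sup_Phi: "op_linear (sup_Phi B)"
  unfolding sup_Phi_def
  by (rule op_linearI)
    (simp_all add: matrix_add_ldistrib matrix_add_rdistrib sum.distrib cscale_mult_left
      cscale_mult_right cop.scale_sum_right)

lemma sup_Phi_adj_mat: "sup_Phi B (adj_mat X) = adj_mat (sup_Phi B X)"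
  by (simp add: sup_Phi_def adj_mat_sum adj_mat_mult matrix_mul_assoc)

text \<open>The left factor E is expanded in the second basis. Moved inside the adjoint on the
  right, each coefficient is conjugated and becomes \<open>hs_inner E F\<close>, so the sum over E
  is the expansion of F in the first basis.\<close>

lemma sup_Phi_onb_independent:
  assumes B: "is_onb B V" and B': "is_onb B' V"
  shows "sup_Phi B X = sup_Phi B' X"
proof -
  have sub: "B \<subseteq> V" "B' \<subseteq> V"
    using B B' cop.span_superset unfolding is_onb_def by blast+
  have "sup_Phi B X = (\<Sum>E\<in>B. (\<Sum>F\<in>B'. cscale (hs_inner F E) F) ** X ** adj_mat E)"
    unfolding sup_Phi_def
    by (intro sum.cong refl arg_cong2[where f = "(**)"] onb_expansion[OF B'] subsetD[OF sub(1)])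
  also have "\<dots> = (\<Sum>E\<in>B. \<Sum>F\<in>B'. cscale (hs_inner F E) (F ** X ** adj_mat E))"
    by (simp only: matrix_sum_rdistrib cscale_mult_left)
  also have "\<dots> = (\<Sum>F\<in>B'. \<Sum>E\<in>B. cscale (hs_inner F E) (F ** X ** adj_mat E))"
    by (rule sum.swap)
  also have "\<dots> = (\<Sum>F\<in>B'. F ** X ** adj_mat (\<Sum>E\<in>B. cscale (hs_inner E F) E))"
    by (simp only: matrix_sum_ldistrib adj_mat_sum adj_mat_cscale cscale_mult_right
        hs_inner_commute[symmetric])
  also have "\<dots> = sup_Phi B' X"
    unfolding sup_Phi_def
    by (intro sum.cong refl arg_cong2[where f = "(**)"] arg_cong[where f = adj_mat]
        onb_expansion[OF B, symmetric] subsetD[OF sub(2)])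
  finally show ?thesis .
qed

lemma op_linear_sandwich: "op_linear (\<lambda>X. M ** X ** N)"
  by (rule op_linearI)
    (simp_all add: matrix_add_ldistrib matrix_add_rdistrib cscale_mult_left cscale_mult_right)

lemma sandwich_cancel:
  assumes "M ** N = mat 1"
  shows "M ** (N ** X ** M') ** N' = X ** (M' ** N')"
proof -
  have "M ** (N ** X ** M') ** N' = (M ** N) ** X ** (M' ** N')"
    by (simp add: matrix_mul_assoc)
  then show ?thesis
    by (simp add: assms)
qed

lemma inj_conjugate:
  assumes "unitary U"
  shows "inj (\<lambda>E. adj_mat U ** E ** U)"
proof (rule inj_on_inverseI)
  show "U ** (adj_mat U ** E ** U) ** adj_mat U = E" for E
    using assms by (simp add: unitary_def sandwich_cancel)
qed

lemma is_onb_conjugate: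
  assumes U: "unitary U" and B: "is_onb B V"
    and V: "\<And>X. X \<in> V \<Longrightarrow> U ** X ** adj_mat U \<in> V" "\<And>X. X \<in> V \<Longrightarrow> adj_mat U ** X ** U \<in> V"
  shows "is_onb ((\<lambda>E. adj_mat U ** E ** U) ` B) V"
proof -
  let ?c = "\<lambda>E. adj_mat U ** E ** U"
  have U': "U ** adj_mat U = mat 1" "adj_mat U ** U = mat 1"
    using U by (auto simp: unitary_def)
  have "?c ` V = V"
  proof
    show "?c ` V \<subseteq> V"
      using V(2) by blast
    show "V \<subseteq> ?c ` V"
    proof
      fix X assume "X \<in> V"
      moreover have "X = ?c (U ** X ** adj_mat U)"
        by (simp add: sandwich_cancel[OF U'(2)] U')
      ultimately show "X \<in> ?c ` V"
        using V(1) by blast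
    qed
  qed
  then have span: "cop.span (?c ` B) = V"
    using module_hom.span_image[OF op_linear_sandwich, of "adj_mat U" U B] B
    by (simp only: is_onb_def)
  have eq: "?c E = ?c F \<longleftrightarrow> E = F" for E F
    using inj_conjugate[OF U] by (rule inj_eq)
  have "hs_inner (?c E) (?c F) = (if ?c E = ?c F then 1 else 0)" if "E \<in> B" "F \<in> B" for E F
    using B that unfolding hs_inner_conjugate[OF U'(1)] eq is_onb_def by blast
  moreover have "finite (?c ` B)"
    using B by (simp add: is_onb_def)
  ultimately show ?thesis
    unfolding is_onb_def span by blast
qed

text \<open>Conjugation by U preserves the inner product and maps V onto itself, so the inner
  \<open>sup_Phi\<close> may be computed in the conjugated basis; the outer factors U then
  cancel.\<close>

lemma sup_Phi_conjugate:
  assumes U: "unitary U" and B: "is_onb B V"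
    and V: "\<And>X. X \<in> V \<Longrightarrow> U ** X ** adj_mat U \<in> V" "\<And>X. X \<in> V \<Longrightarrow> adj_mat U ** X ** U \<in> V"
  shows "sup_Phi B (U ** X ** adj_mat U) = U ** sup_Phi B X ** adj_mat U"
proof -
  let ?c = "\<lambda>E. adj_mat U ** E ** U"
  have U': "U ** adj_mat U = mat 1" "adj_mat U ** U = mat 1"
    using U by (auto simp: unitary_def)
  have inj: "inj_on ?c B"
    using inj_conjugate[OF U] by (rule inj_on_subset) simp
  have "sup_Phi B X = (\<Sum>E\<in>B. ?c E ** X ** adj_mat (?c E))"
    using sup_Phi_onb_independent[OF B is_onb_conjugate[OF assms], of X]
    by (simp only: sup_Phi_def sum.reindex[OF inj] o_def)
  then have "U ** sup_Phi B X ** adj_mat U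
      = (\<Sum>E\<in>B. (U ** adj_mat U) ** E ** (U ** X ** adj_mat U) ** adj_mat E ** (U ** adj_mat U))"
    by (simp only: matrix_sum_ldistrib matrix_sum_rdistrib adj_mat_mult adj_mat_adj_mat
        matrix_mul_assoc)
  then show ?thesis
    by (simp add: U' sup_Phi_def)
qed


subsection \<open>The layers of a quantum graph metric\<close>

text \<open>The empty product is \<open>mat 1\<close>, so the separate case below radius 1 is the
  zeroth power, and the layers can be treated with natural indices throughout.\<close>

lemma graph_metric_of_nat: "graph_metric S (real t) = op_power S t"
proof (cases "t = 0")
  case True
  have "{foldr (**) Es (mat 1) |Es. length Es = 0 \<and> set Es \<subseteq> S} = {mat 1}"
    by auto
  then show ?thesis
    using True by (simp add: graph_metric_def op_power_def)
qed (simp add: graph_metric_def)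

lemma layer_0: "layer S 0 = op_power S 0"
  using graph_metric_of_nat[of S 0] by (simp add: layer_def graph_metric_def)

lemma layer_Suc: "layer S (Suc t) = op_power S (Suc t) \<inter> hs_perp (op_power S t)"
  using graph_metric_of_nat[of S t] graph_metric_of_nat[of S "Suc t"] by (simp add: layer_def)

lemma layer_subset: "layer S t \<subseteq> op_power S t"
  by (cases t) (auto simp: layer_0 layer_Suc)

lemma subspace_op_power: "cop.subspace (op_power S t)"
  by (simp add: op_power_def)

text \<open>A product is lengthened without changing its value by a factor
  \<open>mat 1\<close>.\<close>

lemma op_power_mono:
  assumes "mat 1 \<in> S" "i \<le> j"
  shows "op_power S i \<subseteq> op_power S j"
  using assms(2)
proof (induction rule: dec_induct)
  case (step j)
  have "op_power S j \<subseteq> op_power S (Suc j)"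
    unfolding op_power_def
  proof (rule cop.span_mono, safe)
    fix Es assume "j = length Es" "set Es \<subseteq> S"
    then show "\<exists>Es'. foldr (**) Es (mat 1) = foldr (**) Es' (mat 1) \<and> length Es' = Suc (length Es)
        \<and> set Es' \<subseteq> S"
      using assms(1) by (intro exI[of _ "mat 1 # Es"]) simp
  qed
  with step show ?case by blast
qed simp

text \<open>The layer of smaller index lies in the power just below the larger index, to which the
  other layer is orthogonal by construction. Conjugate symmetry reduces the remaining case to this
  one.\<close>

lemma layer_orthogonal:
  assumes "mat 1 \<in> S" "i \<noteq> j" "E \<in> layer S i" "F \<in> layer S j"
  shows "hs_inner E F = 0"
proof -
  have *: "hs_inner E F = 0" if "i < j" "E \<in> layer S i" "F \<in> layer S j" for i j E F
  proof -
    obtain k where k: "j = Suc k" "i \<le> k"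
      using \<open>i < j\<close> by (auto elim: less_natE)
    have "E \<in> op_power S k"
      using layer_subset op_power_mono[OF assms(1) k(2)] that(2) by blast
    then show ?thesis
      using that(3) by (simp add: k layer_Suc hs_perp_def)
  qed
  show ?thesis
    using *[of i j E F] *[of j i F E] assms(2-4) hs_inner_commute[of E F]
    by (cases i j rule: linorder_cases) auto
qed

lemma foldr_mult: "foldr (**) Es A = foldr (**) Es (mat 1) ** A"
  by (induction Es) (simp_all add: matrix_mul_assoc)

lemma adj_mat_foldr: "adj_mat (foldr (**) Es (mat 1)) = foldr (**) (map adj_mat (rev Es)) (mat 1)"
proof (induction Es)
  case (Cons E Es)
  then show ?case
    by (simp add: adj_mat_mult foldr_mult[of _ "adj_mat E"])
qed simp

text \<open>The adjoint reverses a product of generators. Being only conjugate-linear, it is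
  extended to spans by minimality: the operators whose adjoint lies in the span still form a complex
  subspace.\<close>

lemma adj_mat_op_power:
  assumes "generating_space S" "X \<in> op_power S t"
  shows "adj_mat X \<in> op_power S t"
proof -
  have S: "adj_mat ` S = S"
    using assms(1) by (simp add: generating_space_def)
  let ?P = "{foldr (**) Es (mat 1) |Es. length Es = t \<and> set Es \<subseteq> S}"
  have "adj_mat ` ?P \<subseteq> ?P"
  proof safe
    fix Es assume Es: "t = length Es" "set Es \<subseteq> S"
    then have "set (map adj_mat (rev Es)) \<subseteq> S"
      using S by auto
    then show "\<exists>Es'. adj_mat (foldr (**) Es (mat 1)) = foldr (**) Es' (mat 1)
        \<and> length Es' = length Es \<and> set Es' \<subseteq> S"
      by (intro exI[of _ "map adj_mat (rev Es)"]) (simp add: adj_mat_foldr)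
  qed
  then have "?P \<subseteq> {X. adj_mat X \<in> cop.span ?P}"
    using cop.span_superset[of ?P] by blast
  moreover have "cop.subspace {X. adj_mat X \<in> cop.span ?P}"
    by (auto simp: cop.subspace_def cop.span_zero adj_mat_add adj_mat_cscale
        intro: cop.span_add cop.span_scale)
  ultimately have "cop.span ?P \<subseteq> {X. adj_mat X \<in> cop.span ?P}"
    by (rule cop.span_minimal)
  then show ?thesis
    using assms(2) by (auto simp: op_power_def)
qed

lemma adj_mat_layer:
  assumes "generating_space S" "X \<in> layer S t"
  shows "adj_mat X \<in> layer S t"
proof (cases t)
  case 0
  then show ?thesis
    using adj_mat_op_power assms by (simp add: layer_0)
next
  case (Suc k)
  then show ?thesis
    using assms adj_mat_op_power[OF assms(1)]
    by (simp add: layer_Suc hs_perp_def hs_inner_adj)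
qed

text \<open>The inductive step peels off the top layer: the remainder of \<open>X\<close> is orthogonal to the smaller
  power by self-adjointness of the projections.\<close>

lemma sum_sup_Pi_op_power:
  assumes S: "generating_space S" and B: "\<And>j. j \<le> t \<Longrightarrow> is_onb (B j) (layer S j)"
    and "X \<in> op_power S t"
  shows "(\<Sum>j\<le>t. sup_Pi (B j) X) = X"
  using B \<open>X \<in> op_power S t\<close>
proof (induction t arbitrary: X)
  case 0
  then show ?case
    using sup_Pi_of_mem[of "B 0" "layer S 0"] by (simp add: layer_0)
next
  case (Suc t)
  have S1: "mat 1 \<in> S"
    using S by (simp add: generating_space_def)
  define Y where "Y = (\<Sum>j\<le>t. sup_Pi (B j) X)"
  have "sup_Pi (B j) X \<in> op_power S t" if "j \<le> t" for j
    using sup_Pi_mem[OF Suc.prems(1)[of j], of X] layer_subset[of S j]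
      op_power_mono[OF S1 that] that by auto
  then have Y: "Y \<in> op_power S t"
    unfolding Y_def by (intro cop.subspace_sum subspace_op_power) auto
  have "hs_inner Z (X - Y) = 0" if "Z \<in> op_power S t" for Z
  proof -
    have "hs_inner Z Y = hs_inner (\<Sum>j\<le>t. sup_Pi (B j) Z) X"
      by (simp add: Y_def hs_inner_sum_left hs_inner_sum_right hs_inner_sup_Pi_left)
    then show ?thesis
      using Suc.IH[OF _ that] Suc.prems(1) by (simp add: hs_inner_diff_right)
  qed
  moreover have "X - Y \<in> op_power S (Suc t)"
    using Suc.prems(2) Y op_power_mono[OF S1, of t "Suc t"]
    by (auto intro!: cop.subspace_diff subspace_op_power)
  ultimately have "X - Y \<in> layer S (Suc t)"
    by (auto simp: layer_Suc hs_perp_def)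
  then have "sup_Pi (B (Suc t)) (X - Y) = X - Y"
    using sup_Pi_of_mem Suc.prems(1) by blast
  moreover have "sup_Pi (B (Suc t)) Y = 0"
  proof (rule sup_Pi_of_orthogonal[OF Suc.prems(1)[OF order_refl]])
    fix E assume "E \<in> layer S (Suc t)"
    then have "hs_inner Y E = 0"
      using Y by (simp add: layer_Suc hs_perp_def)
    then show "hs_inner E Y = 0"
      by (simp add: hs_inner_commute[of E Y])
  qed
  ultimately have "sup_Pi (B (Suc t)) X = X - Y"
    by (simp add: module_hom.diff[OF op_linear_sup_Pi])
  then show ?case
    by (simp add: Y_def)
qed


subsection \<open>Expansion coefficients\<close>

text \<open>Any expansion multiplies a nonzero self-adjoint element of layer i by its i-th
  coefficient, so evaluating there determines that coefficient. Self-adjoint test elements are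
  required because expansions constrain \<Psi> on no others.\<close>

lemma expansion_coeffs_is_expansion:
  assumes S: "generating_space S" and B: "\<And>j. j \<le> r \<Longrightarrow> is_onb (B j) (layer S j)"
    and ne: "\<And>j. j \<le> r \<Longrightarrow> layer S j \<noteq> {0}" and ex: "is_expansion B r \<Psi> w"
  shows "is_expansion B r \<Psi> (expansion_coeffs B r \<Psi>)"
  unfolding expansion_coeffs_def
proof (rule theI[where P = "is_expansion B r \<Psi>", OF ex])
  fix v assume v: "is_expansion B r \<Psi> v"
  have S1: "mat 1 \<in> S"
    using S by (simp add: generating_space_def)
  show "v = w"
  proof
    fix i show "v i = w i"
    proof (cases "i \<le> r")
      case True
      have sub: "cop.subspace (layer S i)"
        using B[OF True] cop.subspace_span[of "B i"] by (simp add: is_onb_def)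
      then obtain X where X: "X \<in> layer S i" "X \<noteq> 0"
        using ne[OF True] cop.subspace_0 by blast
      \<comment> \<open>X plus its adjoint serves unless it vanishes; then X is anti-self-adjoint
        and \<i> times X serves.\<close>
      obtain Y where Y: "Y \<in> layer S i" "Y \<noteq> 0" "self_adjoint Y"
      proof (cases "X + adj_mat X = 0")
        case True
        then have "adj_mat X = - X"
          by (simp add: eq_neg_iff_add_eq_0 add.commute)
        then have "self_adjoint (cscale \<i> X)"
          by (simp add: self_adjoint_def adj_mat_cscale)
        then show thesis
          using that[of "cscale \<i> X"] X cop.subspace_scale[OF sub] by simp
      next
        case False
        then show thesis
          using that[of "X + adj_mat X"] X adj_mat_layer[OF S] cop.subspace_add[OF sub]
          by (simp add: self_adjoint_def adj_mat_add add.commute)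
      qed
      have Pi_Y: "sup_Pi (B j) Y = (if j = i then Y else 0)" if "j \<le> r" for j
        using sup_Pi_of_mem[OF B[OF that]] sup_Pi_of_orthogonal[OF B[OF that]]
          layer_orthogonal[OF S1 _ _ Y(1)] Y(1) by auto
      have "\<Psi> Y = u i *\<^sub>R Y" if "is_expansion B r \<Psi> u" for u
      proof -
        have "\<Psi> Y = (\<Sum>j\<le>r. u j *\<^sub>R sup_Pi (B j) Y)"
          using that Y(3) by (simp add: is_expansion_def)
        also have "\<dots> = (\<Sum>j\<le>r. if j = i then u j *\<^sub>R Y else 0)"
          by (intro sum.cong) (auto simp: Pi_Y)
        finally show ?thesis
          using True by simp
      qed
      from this[OF v] this[OF ex] Y(2) show ?thesis
        by simp
    qed (use v ex in \<open>simp add: is_expansion_def\<close>)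
  qed
qed

lemma multiplicity_free_expansion:
  assumes S: "generating_space S" and r: "graph_metric S (real r) = UNIV"
    and B: "\<And>j. j \<le> r \<Longrightarrow> is_onb (B j) (layer S j)"
    and mf: "multiplicity_free G \<rho>" and hom: "two_homogeneous G \<rho> S r"
    and \<rho>: "\<And>g. g \<in> carrier G \<Longrightarrow> op_linear (\<rho> g)"
    and lin: "op_linear \<Psi>" and eqv: "equivariant G \<rho> \<Psi>"
    and adj: "\<And>X. \<Psi> (adj_mat X) = adj_mat (\<Psi> X)"
  shows "\<exists>w. (\<forall>j>r. w j = 0) \<and> (\<forall>X. \<Psi> X = (\<Sum>j\<le>r. w j *\<^sub>R sup_Pi (B j) X))"
proof -
  interpret \<Psi>: module_hom cscale cscale \<Psi> by fact
  have "\<exists>a::real. \<forall>X\<in>layer S j. \<Psi> X = a *\<^sub>R X" if "j \<le> r" for j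
  proof -
    have irr: "irreducible_subrep G \<rho> (layer S j)"
      using hom that by (simp add: two_homogeneous_def)
    obtain c where c: "\<And>X. X \<in> layer S j \<Longrightarrow> \<Psi> X = cscale c X"
      using multiplicity_free_scalar[OF mf irr lin eqv \<rho>] by blast
    have "0 \<in> layer S j" "layer S j \<noteq> {0}"
      using irr by (simp_all add: irreducible_subrep_def invariant_subspace_def cop.subspace_0)
    then obtain X where X: "X \<in> layer S j" "X \<noteq> 0"
      by blast
    \<comment> \<open>Evaluating \<Psi> at the adjoint of X, directly and through compatibility with
      adjoints, equates c with its conjugate.\<close>
    have "cscale c (adj_mat X) = cscale (cnj c) (adj_mat X)"
      unfolding c[OF adj_mat_layer[OF S X(1)], symmetric] adj c[OF X(1)] by (rule adj_mat_cscale)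
    then have "c = cnj c"
      unfolding cop.scale_cancel_right adj_mat_eq_0_iff using X(2) by blast
    then have "c = of_real (Re c)"
      by (simp add: complex_eq_iff)
    then show ?thesis
      using c by (metis scaleR_eq_cscale)
  qed
  then obtain a where a: "\<And>j X. j \<le> r \<Longrightarrow> X \<in> layer S j \<Longrightarrow> \<Psi> X = a j *\<^sub>R X"
    by metis
  show ?thesis
  \<comment> \<open>The value 0 beyond r is the normalisation that \<open>is_expansion\<close>
    demands.\<close>
  proof (intro exI[of _ "\<lambda>j. if j \<le> r then a j else 0"] conjI allI)
    fix X
    have "X \<in> op_power S r"
      using r by (simp add: graph_metric_of_nat)
    then have "\<Psi> X = (\<Sum>j\<le>r. \<Psi> (sup_Pi (B j) X))"
      using sum_sup_Pi_op_power[OF S B] by (metis \<Psi>.sum)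
    also have "\<dots> = (\<Sum>j\<le>r. (if j \<le> r then a j else 0) *\<^sub>R sup_Pi (B j) X)"
      by (intro sum.cong refl) (use a sup_Pi_mem[OF B] in auto)
    finally show "\<Psi> X = (\<Sum>j\<le>r. (if j \<le> r then a j else 0) *\<^sub>R sup_Pi (B j) X)" .
  qed simp
qed


subsection \<open>Equivariance\<close>

lemma op_linear_op_action: "op_linear (op_action R g)"
  unfolding op_action_def by (rule op_linear_sandwich)

lemma hom_isom_group_unitary:
  assumes "R \<in> hom G (isom_group M)" "g \<in> carrier G"
  shows "unitary (R g)"
  using hom_in_carrier[OF assms] by (simp add: isom_group_def)

text \<open>Multiplicativity gives R(1) = R(1) R(1), and cancelling the unitary R(1) yields the
  identity matrix. The inverse of the unitary \<open>R g\<close> is then its adjoint.\<close>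

lemma hom_isom_group_inv:
  assumes "group G" "R \<in> hom G (isom_group M)" "g \<in> carrier G"
  shows "R (inv\<^bsub>G\<^esub> g) = adj_mat (R g)"
proof -
  interpret group G by fact
  have mult: "R (x \<otimes>\<^bsub>G\<^esub> y) = R x ** R y" if "x \<in> carrier G" "y \<in> carrier G" for x y
    using hom_mult[OF assms(2) that] by (simp add: isom_group_def)
  have "R \<one>\<^bsub>G\<^esub> = adj_mat (R \<one>\<^bsub>G\<^esub>) ** (R \<one>\<^bsub>G\<^esub> ** R \<one>\<^bsub>G\<^esub>)"
    using hom_isom_group_unitary[OF assms(2)] by (simp add: unitary_def matrix_mul_assoc)
  then have one: "R \<one>\<^bsub>G\<^esub> = mat 1"
    using mult[of "\<one>\<^bsub>G\<^esub>" "\<one>\<^bsub>G\<^esub>"] hom_isom_group_unitary[OF assms(2)] by (simp add: unitary_def)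
  have U: "R g ** adj_mat (R g) = mat 1"
    using hom_isom_group_unitary[OF assms(2,3)] by (simp add: unitary_def)
  have "R (inv\<^bsub>G\<^esub> g) ** R g = mat 1"
    using mult[of "inv\<^bsub>G\<^esub> g" g] assms(3) one by simp
  then have "R (inv\<^bsub>G\<^esub> g) ** (R g ** adj_mat (R g)) = adj_mat (R g)"
    by (simp add: matrix_mul_assoc)
  then show ?thesis
    by (simp add: U)
qed

lemma equivariant_sup_Phi:
  assumes G: "group G" and R: "R \<in> hom G (isom_group M)" and B: "is_onb B V"
    and V: "invariant_subspace G (op_action R) V"
  shows "equivariant G (op_action R) (sup_Phi B)"
  unfolding equivariant_def op_action_def
proof (intro ballI allI)
  fix g X assume g: "g \<in> carrier G"
  show "sup_Phi B (R g ** X ** adj_mat (R g)) = R g ** sup_Phi B X ** adj_mat (R g)"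
  proof (rule sup_Phi_conjugate[OF hom_isom_group_unitary[OF R g] B])
    fix Y assume Y: "Y \<in> V"
    then show "R g ** Y ** adj_mat (R g) \<in> V"
      using V g by (auto simp: invariant_subspace_def op_action_def)
    \<comment> \<open>Stability under conjugation in the opposite direction is invariance under the
      inverse group element.\<close>
    have "op_action R (inv\<^bsub>G\<^esub> g) Y \<in> V"
      using V group.inv_closed[OF G g] Y by (auto simp: invariant_subspace_def)
    then show "adj_mat (R g) ** Y ** R g \<in> V"
      by (simp add: op_action_def hom_isom_group_inv[OF G R g])
  qed
qed

lemma conj_mat_adj_mat: "conj_mat (adj_mat A) = adj_mat (conj_mat A)"
  by (simp add: vec_eq_iff)

lemma sup_T_mult:
  assumes "unitary \<Lambda>"
  shows "sup_T \<Lambda> (X ** Y) = sup_T \<Lambda> X ** sup_T \<Lambda> Y"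
proof -
  have "sup_T \<Lambda> X ** sup_T \<Lambda> Y = \<Lambda> ** conj_mat X ** (adj_mat \<Lambda> ** \<Lambda>) ** conj_mat Y ** adj_mat \<Lambda>"
    by (simp only: sup_T_def matrix_mul_assoc)
  also have "\<dots> = \<Lambda> ** conj_mat X ** conj_mat Y ** adj_mat \<Lambda>"
    using assms by (simp add: unitary_def)
  finally show ?thesis
    by (simp add: sup_T_def conj_mat_mult matrix_mul_assoc)
qed

lemma sup_T_adj_mat: "sup_T \<Lambda> (adj_mat X) = adj_mat (sup_T \<Lambda> X)"
  by (simp add: sup_T_def adj_mat_mult conj_mat_adj_mat matrix_mul_assoc)

text \<open>Two conjugate-linear maps compose to a linear one: the conjugate of the adjoint is the
  transpose, so this is conjugation by \<Lambda> of the transpose of X.\<close>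

lemma op_linear_sup_T_adj: "op_linear (\<lambda>X. sup_T \<Lambda> (adj_mat X))"
proof (rule op_linearI)
  have "conj_mat (A + B) = conj_mat A + conj_mat B" for A B :: "'a cop"
    by (simp add: vec_eq_iff)
  then show "sup_T \<Lambda> (adj_mat (X + Y)) = sup_T \<Lambda> (adj_mat X) + sup_T \<Lambda> (adj_mat Y)" for X Y
    by (simp add: sup_T_def adj_mat_add matrix_add_ldistrib matrix_add_rdistrib)
  have "conj_mat (cscale c A) = cscale (cnj c) (conj_mat A)" for c and A :: "'a cop"
    by (simp add: vec_eq_iff)
  then show "sup_T \<Lambda> (adj_mat (cscale c X)) = cscale c (sup_T \<Lambda> (adj_mat X))" for c X
    by (simp add: sup_T_def adj_mat_cscale cscale_mult_left cscale_mult_right)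
qed

text \<open>Self-duality says that \<open>sup_T \<Lambda>\<close> fixes every \<open>R g\<close>. As
  it is multiplicative and commutes with adjoints, it passes through the conjugation by
  \<open>R g\<close>.\<close>

lemma equivariant_sup_T_adj:
  assumes "self_dual_via G R \<Lambda>"
  shows "equivariant G (op_action R) (\<lambda>X. sup_T \<Lambda> (adj_mat X))"
  unfolding equivariant_def op_action_def
proof (intro ballI allI)
  fix g X assume "g \<in> carrier G"
  then have "sup_T \<Lambda> (R g) = R g" "unitary \<Lambda>"
    using assms by (auto simp: self_dual_via_def sup_T_def)
  then show "sup_T \<Lambda> (adj_mat (R g ** X ** adj_mat (R g)))
      = R g ** sup_T \<Lambda> (adj_mat X) ** adj_mat (R g)"
    by (simp add: adj_mat_mult sup_T_mult sup_T_adj_mat matrix_mul_assoc)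
qed


subsection \<open>Positivity\<close>

lemma Re_trace_sup_Phi_nonneg:
  assumes "self_adjoint P" "P ** P = P" "self_adjoint Q" "Q ** Q = Q"
  shows "Re (trace (P ** sup_Phi B Q)) \<ge> 0"
proof -
  have "trace (P ** (E ** Q ** adj_mat E)) = hs_inner (Q ** adj_mat E ** P) (Q ** adj_mat E ** P)" for E
  proof -
    \<comment> \<open>Idempotence doubles P and Q; cyclicity then moves one P to the end, leaving
      the squared norm of the adjoint of P E Q.\<close>
    have "trace (P ** (E ** Q ** adj_mat E)) = trace (P ** (P ** E ** Q ** Q ** adj_mat E))"
      by (simp only: matrix_mul_assoc assms) (simp only: matrix_mul_assoc[symmetric] assms)
    also have "\<dots> = trace (P ** E ** Q ** Q ** adj_mat E ** P)"
      by (rule trace_mul_sym)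
    also have "\<dots> = hs_inner (Q ** adj_mat E ** P) (Q ** adj_mat E ** P)"
      using assms(1,3) by (simp add: hs_inner_def self_adjoint_def adj_mat_mult matrix_mul_assoc)
    finally show ?thesis .
  qed
  then show ?thesis
    by (simp add: sup_Phi_def matrix_sum_ldistrib trace_sum Re_hs_inner_self_nonneg sum_nonneg)
qed

theorem theorem3p3p1:
  fixes G :: "('g, 'm) monoid_scheme"
    and R :: "'g \<Rightarrow> complex ^ 'n ^ 'n"
    and S :: "(complex ^ 'n ^ 'n) set"
    and B :: "nat \<Rightarrow> (complex ^ 'n ^ 'n) set"
    and \<Lambda> P :: "complex ^ 'n ^ 'n"
    and C :: "(complex ^ 'n) set"
    and r t :: nat
  assumes "group G"
    and "generating_space S"
    and "has_diameter S r"
    and "R \<in> hom G (isom_group (graph_metric S))"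
    and "multiplicity_free G (op_action R)"
    and "two_homogeneous G (op_action R) S r"
    and "\<And>j. j \<le> r \<Longrightarrow> is_onb (B j) (layer S j)"
    and "self_dual_via G R \<Lambda>"
    and "vec.subspace C"
    and "is_orth_proj P C"
    and "t \<le> r"
  shows "(\<Sum>j\<le>r. T_coeff B r \<Lambda> j * W_coeff B r t j * distance_distribution (B j) C P) \<ge> 0"
proof -
  note B = assms(7)
  have r: "graph_metric S (real r) = UNIV"
    using assms(3) by (simp add: has_diameter_def)
  have S1: "mat 1 \<in> S"
    using assms(2) by (simp add: generating_space_def)
  have layer: "invariant_subspace G (op_action R) (layer S j)" "layer S j \<noteq> {0}" if "j \<le> r" for j
    using assms(6) that by (auto simp: two_homogeneous_def irreducible_subrep_def)
  have expand: "\<exists>w. (\<forall>j>r. w j = 0) \<and> (\<forall>X. \<Psi> X = (\<Sum>j\<le>r. w j *\<^sub>R sup_Pi (B j) X))"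
    if "op_linear \<Psi>" "equivariant G (op_action R) \<Psi>" "\<And>X. \<Psi> (adj_mat X) = adj_mat (\<Psi> X)" for \<Psi>
    by (rule multiplicity_free_expansion[OF assms(2) r B assms(5,6) op_linear_op_action that])
  have coeffs: "is_expansion B r \<Psi> (expansion_coeffs B r \<Psi>)" if "is_expansion B r \<Psi> w" for \<Psi> w
    by (rule expansion_coeffs_is_expansion[OF assms(2) B layer(2) that])

  have "equivariant G (op_action R) (sup_Phi (B t))"
    by (rule equivariant_sup_Phi[OF assms(1,4) B[OF assms(11)] layer(1)[OF assms(11)]])
  from expand[OF op_linear_sup_Phi this sup_Phi_adj_mat]
  obtain w where "\<forall>j>r. w j = 0" "\<forall>X. sup_Phi (B t) X = (\<Sum>j\<le>r. w j *\<^sub>R sup_Pi (B j) X)"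
    by (elim exE conjE) (rule that)
  then have "is_expansion B r (sup_Phi (B t)) w"
    by (simp add: is_expansion_def)
  then have W: "is_expansion B r (sup_Phi (B t)) (W_coeff B r t)"
    unfolding W_coeff_def by (rule coeffs)

  have "\<exists>v. (\<forall>j>r. v j = 0)
      \<and> (\<forall>X. sup_T \<Lambda> (adj_mat X) = (\<Sum>j\<le>r. v j *\<^sub>R sup_Pi (B j) X))"
    by (rule expand[OF op_linear_sup_T_adj equivariant_sup_T_adj[OF assms(8)] sup_T_adj_mat])
  then obtain v where v: "\<forall>j>r. v j = 0"
      "\<forall>X. sup_T \<Lambda> (adj_mat X) = (\<Sum>j\<le>r. v j *\<^sub>R sup_Pi (B j) X)"
    by (elim exE conjE) (rule that)
  have "sup_T \<Lambda> X = (\<Sum>j\<le>r. v j *\<^sub>R sup_Pi (B j) X)" if "self_adjoint X" for X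
    using v(2)[rule_format, of X] that by (simp add: self_adjoint_def)
  then have "is_expansion B r (sup_T \<Lambda>) v"
    using v(1) by (simp add: is_expansion_def)
  then have T: "is_expansion B r (sup_T \<Lambda>) (T_coeff B r \<Lambda>)"
    unfolding T_coeff_def by (rule coeffs)

  have P: "self_adjoint P" "P ** P = P"
    using assms(10) by (auto simp: is_orth_proj_def)
  define Q where "Q = sup_T \<Lambda> P"
  have Q: "self_adjoint Q" "Q ** Q = Q"
    using P assms(8) unfolding Q_def
    by (simp_all add: self_adjoint_def self_dual_via_def flip: sup_T_adj_mat sup_T_mult)
  \<comment> \<open>Orthogonality of the layers lets \<Lambda>'s coefficients be read off blockwise:
    projecting the expansion of Q onto layer j leaves a single term.\<close>
  have Pi_Q: "sup_Pi (B j) Q = T_coeff B r \<Lambda> j *\<^sub>R sup_Pi (B j) P" if j: "j \<le> r" for j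
  proof -
    interpret Pi: module_hom cscale cscale "sup_Pi (B j)" by (rule op_linear_sup_Pi)
    have Pi_Pi: "sup_Pi (B j) (sup_Pi (B i) P) = (if i = j then sup_Pi (B i) P else 0)" if "i \<le> r" for i
      using sup_Pi_of_mem[OF B[OF j]] sup_Pi_of_orthogonal[OF B[OF j]]
        layer_orthogonal[OF S1, of j i] sup_Pi_mem[OF B[OF that], of P] by auto
    have "Q = (\<Sum>i\<le>r. T_coeff B r \<Lambda> i *\<^sub>R sup_Pi (B i) P)"
      using T P(1) by (simp add: Q_def is_expansion_def)
    then have "sup_Pi (B j) Q = (\<Sum>i\<le>r. T_coeff B r \<Lambda> i *\<^sub>R sup_Pi (B j) (sup_Pi (B i) P))"
      by (simp add: Pi.sum Pi.scale scaleR_eq_cscale)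
    also have "\<dots> = (\<Sum>i\<le>r. if i = j then T_coeff B r \<Lambda> i *\<^sub>R sup_Pi (B i) P else 0)"
      by (intro sum.cong) (auto simp: Pi_Pi)
    finally show ?thesis
      using j by simp
  qed
  \<comment> \<open>The expansion of \<open>sup_Phi (B t)\<close> is available at Q because Q is
    self-adjoint.\<close>
  have "sup_Phi (B t) Q = (\<Sum>j\<le>r. W_coeff B r t j *\<^sub>R sup_Pi (B j) Q)"
    using W Q(1) by (simp add: is_expansion_def)
  also have "\<dots> = (\<Sum>j\<le>r. (T_coeff B r \<Lambda> j * W_coeff B r t j) *\<^sub>R sup_Pi (B j) P)"
    by (intro sum.cong) (auto simp: Pi_Q)
  finally have "Re (trace (P ** sup_Phi (B t) Q))
      = (\<Sum>j\<le>r. T_coeff B r \<Lambda> j * W_coeff B r t j * Re (trace (P ** sup_Pi (B j) P)))"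
    by (simp add: matrix_sum_ldistrib trace_sum scaleR_eq_cscale cscale_mult_right trace_cscale)
  moreover have "Re (trace (P ** sup_Phi (B t) Q)) \<ge> 0"
    by (rule Re_trace_sup_Phi_nonneg[OF P Q])
  \<comment> \<open>The common factor is non-negative; for the zero code the division makes it 0 and
    the inequality is trivial.\<close>
  moreover have "(\<Sum>j\<le>r. T_coeff B r \<Lambda> j * W_coeff B r t j * distance_distribution (B j) C P)
      = real CARD('n) / real (vec.dim C)
        * (\<Sum>j\<le>r. T_coeff B r \<Lambda> j * W_coeff B r t j * Re (trace (P ** sup_Pi (B j) P)))"
    unfolding distance_distribution_def sum_distrib_left by (intro sum.cong) auto
  ultimately show ?thesis
    by simp
qed

end
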